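(* Let $Q(\xi,y)=S(\xi)+q(\xi)yy^\top$. Fix a point $(\xi_0,y)$ with $y\in\mathbb R^m$, $y\neq0$, a symmetric positive-definite $m\times m$ matrix $S_0$, and any prescribed value of $q'(\xi_0)$, including $q'(\xi_0)\neq0$. Then there exists a smooth path $\xi\mapsto S(\xi)$ of symmetric positive-definite matrices, defined on a neighbourhood of $\xi_0$, with $S(\xi_0)=S_0$, such that $$\partial_\xi Q(\xi,y)\big|_{\xi=\xi_0}=0 .$$ Consequently, when shape variation is unconstrained (i.e. the path $S$ is arbitrary), no positive lower bound on local quadratic visibility can depend on $q'(\xi_0)$ and $y$ alone: there is no function $c(q'(\xi_0),y)>0$ such that $\|\partial_\xi Q(\xi_0,y)\|_{S(\xi_0)}\ge c(q'(\xi_0),y)$ for all such paths $S$.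
   Context: Here $\xi$ is a scalar slow coordinate with diffusion coefficient $\sigma(\xi)>0$; the observation is $Y=a(\xi)Z$ with $a>0$ and $Z\in\mathbb R^m$ a fast variable with symmetric positive-definite diffusion covariance $D(\xi)$. Along the fibre $Y=y$ the observed quadratic covariance is $Q(\xi,y)=S(\xi)+q(\xi)yy^\top$ with $S(\xi)=a(\xi)^2D(\xi)$ and $q(\xi)=\sigma(\xi)^2(a'(\xi)/a(\xi))^2$, the latter being differentiable at $\xi_0$. The derivative $\partial_\xi$ is taken at fixed $y$. Local quadratic visibility is measured by $\|\partial_\xi Q\|_S$, where $\|H\|_S^2=\operatorname{tr}(S^{-1}HS^{-1}H)$ for symmetric $H$. *)

theory Defs
  imports "HOL-Analysis.Analysis"
begin

definition sym_pos_def :: "real^'m^'m \<Rightarrow> bool" where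
  "sym_pos_def A \<longleftrightarrow> transpose A = A \<and> (\<forall>x. x \<noteq> 0 \<longrightarrow> 0 < x \<bullet> (A *v x))"

definition outer :: "real^'m \<Rightarrow> real^'m^'m" where
  "outer y = (\<chi> i j. y $ i * y $ j)"

text \<open>
  Only used for open \<open>U\<close>: then the iterated derivatives at points of \<open>U\<close> depend on the values
  of \<open>f\<close> on \<open>U\<close> only, and differentiability of all of them is smoothness of \<open>f\<close> on \<open>U\<close>.
\<close>

definition smooth_curve_on :: "real set \<Rightarrow> (real \<Rightarrow> 'a::real_normed_vector) \<Rightarrow> bool" where
  "smooth_curve_on U f \<longleftrightarrow>
     (\<forall>n. \<forall>x\<in>U. ((\<lambda>g t. vector_derivative g (at t)) ^^ n) f differentiable (at x))"

text \<open>
  A smooth path of symmetric positive-definite matrices, defined on a neighbourhood of \<open>\<xi>0\<close>.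
  Values of the total function \<open>S\<close> outside the neighbourhood are irrelevant.
\<close>

definition spd_path_near :: "real \<Rightarrow> (real \<Rightarrow> real^'m^'m) \<Rightarrow> bool" where
  "spd_path_near \<xi>0 S \<longleftrightarrow>
     (\<exists>U. open U \<and> \<xi>0 \<in> U \<and> smooth_curve_on U S \<and> (\<forall>\<xi>\<in>U. sym_pos_def (S \<xi>)))"

definition obs_cov :: "(real \<Rightarrow> real^'m^'m) \<Rightarrow> (real \<Rightarrow> real) \<Rightarrow> real \<Rightarrow> real^'m \<Rightarrow> real^'m^'m" where
  "obs_cov S q \<xi> y = S \<xi> + q \<xi> *\<^sub>R outer y"

definition mat_norm :: "real^'m^'m \<Rightarrow> real^'m^'m \<Rightarrow> real" where
  "mat_norm S H = sqrt (trace (matrix_inv S ** H ** matrix_inv S ** H))"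

definition visibility :: "(real \<Rightarrow> real^'m^'m) \<Rightarrow> (real \<Rightarrow> real) \<Rightarrow> real \<Rightarrow> real^'m \<Rightarrow> real" where
  "visibility S q \<xi>0 y = mat_norm (S \<xi>0) (vector_derivative (\<lambda>\<xi>. obs_cov S q \<xi> y) (at \<xi>0))"

end

theory Submission
  imports Defs
begin

text \<open>
  At fixed \<open>y\<close>, the rank-one term contributes the symmetric matrix \<open>q' yy\<^sup>T\<close> to the derivative of
  the observed covariance, and an unconstrained path of positive definite matrices can have any
  symmetric matrix as its velocity.  So the straight line
  \<open>S(\<xi>) = S\<^sub>0 - (\<xi> - \<xi>\<^sub>0) q' yy\<^sup>T\<close> cancels that variation.  It is
  admissible because positive definiteness is an open condition among symmetric matrices
  (\<open>sym_pos_def_add_small\<close>) and affine curves are smooth (\<open>smooth_curve_on_affine\<close>).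
  Along it the visibility vanishes, which rules out every positive lower bound.
\<close>

text \<open>
  The constant is the minimum of the quadratic form on the compact unit sphere; homogeneity of
  degree two carries the bound to all vectors.
\<close>

lemma sym_pos_def_coercive:
  fixes A :: "real^'m^'m"
  assumes "sym_pos_def A"
  obtains l where "l > 0" "\<And>x. l * (norm x)\<^sup>2 \<le> x \<bullet> (A *v x)"
proof -
  let ?f = "\<lambda>x :: real^'m. x \<bullet> (A *v x)"
  have "continuous_on (sphere 0 1) ?f"
    by (intro continuous_intros matrix_vector_mult_linear_continuous_on)
  moreover have "sphere (0 :: real^'m) 1 \<noteq> {}"
    by simp
  ultimately have "\<exists>u\<in>sphere 0 1. \<forall>v\<in>sphere 0 1. ?f u \<le> ?f v"
    by (intro continuous_attains_inf compact_sphere)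
  then obtain u where u: "u \<in> sphere 0 1" and min: "\<And>v. v \<in> sphere 0 1 \<Longrightarrow> ?f u \<le> ?f v"
    by blast
  have "u \<noteq> 0"
    using u by auto
  with assms have "?f u > 0"
    by (simp add: sym_pos_def_def)
  moreover have "?f u * (norm x)\<^sup>2 \<le> ?f x" for x
  proof (cases "x = 0")
    case False
    have "?f u \<le> ?f ((1 / norm x) *\<^sub>R x)"
      using False by (intro min) simp
    also have "\<dots> = ?f x / (norm x)\<^sup>2"
      by (simp add: matrix_vector_mult_scaleR power2_eq_square)
    finally show ?thesis
      using False by (simp add: field_simps)
  qed simp
  ultimately show thesis
    using that by blast
qed

text \<open>
  With \<open>l\<close> a coercivity constant of \<open>A\<close> and \<open>K\<close> a bound for the operator norm of \<open>H\<close>, the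
  perturbation lowers the quadratic form by at most \<open>\<bar>t\<bar> K (norm x)\<^sup>2\<close>, so \<open>l / K\<close> is a valid radius.
\<close>

lemma sym_pos_def_add_small:
  fixes A H :: "real^'m^'m"
  assumes A: "sym_pos_def A" and H: "transpose H = H"
  obtains e where "e > 0" "\<And>t. \<bar>t\<bar> < e \<Longrightarrow> sym_pos_def (A + t *\<^sub>R H)"
proof -
  obtain l where l: "l > 0" "\<And>x. l * (norm x)\<^sup>2 \<le> x \<bullet> (A *v x)"
    using sym_pos_def_coercive[OF A] by blast
  obtain K where K: "K > 0" "\<And>x. norm (H *v x) \<le> norm x * K"
    using bounded_linear.pos_bounded[OF matrix_vector_mul_bounded_linear[of H]] by blast
  have "sym_pos_def (A + t *\<^sub>R H)" if t: "\<bar>t\<bar> < l / K" for t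
    unfolding sym_pos_def_def
  proof (intro conjI allI impI)
    show "transpose (A + t *\<^sub>R H) = A + t *\<^sub>R H"
      using A H by (simp add: sym_pos_def_def transpose_def vec_eq_iff)
  next
    fix x :: "real^'m"
    assume x: "x \<noteq> 0"
    have "\<bar>x \<bullet> (H *v x)\<bar> \<le> norm x * norm (H *v x)"
      by (rule Cauchy_Schwarz_ineq2)
    also have "\<dots> \<le> norm x * (norm x * K)"
      by (intro mult_left_mono K) simp
    finally have "\<bar>x \<bullet> (H *v x)\<bar> \<le> K * (norm x)\<^sup>2"
      by (simp add: power2_eq_square mult_ac)
    then have "\<bar>t * (x \<bullet> (H *v x))\<bar> \<le> \<bar>t\<bar> * (K * (norm x)\<^sup>2)"
      unfolding abs_mult by (intro mult_left_mono) simp_all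
    also have "\<dots> = (\<bar>t\<bar> * K) * (norm x)\<^sup>2"
      by simp
    also have "\<dots> < l * (norm x)\<^sup>2"
      using t K x by (intro mult_strict_right_mono) (simp_all add: field_simps)
    also have "\<dots> \<le> x \<bullet> (A *v x)"
      by (rule l)
    finally show "0 < x \<bullet> ((A + t *\<^sub>R H) *v x)"
      by (simp add: matrix_vector_mult_add_rdistrib inner_add_right
          scaleR_matrix_vector_assoc[symmetric])
  qed
  then show thesis
    using that[of "l / K"] l K by simp
qed

lemma has_vector_derivative_affine:
  "((\<lambda>t. a + (t - s) *\<^sub>R b) has_vector_derivative b) (at t)"
proof -
  have "((\<lambda>t. t - s) has_real_derivative 1) (at t)"
    by (auto intro!: derivative_eq_intros)
  from has_vector_derivative_add[OF has_vector_derivative_const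
      has_vector_derivative_scaleR[OF this has_vector_derivative_const]]
  show ?thesis by simp
qed

lemma smooth_curve_on_affine:
  fixes a b :: "'a::real_normed_vector"
  shows "smooth_curve_on U (\<lambda>t. a + (t - s) *\<^sub>R b)"
proof -
  let ?D = "\<lambda>g :: real \<Rightarrow> 'a. \<lambda>t. vector_derivative g (at t)"
  \<comment> \<open>Affine curves are closed under differentiation, the derivative having slope zero.\<close>
  have "\<exists>a' b'. (?D ^^ n) (\<lambda>t. a + (t - s) *\<^sub>R b) = (\<lambda>t. a' + (t - s) *\<^sub>R b')" for n
  proof (induction n)
    case 0
    show ?case by auto
  next
    case (Suc n)
    then obtain a' b' where "(?D ^^ n) (\<lambda>t. a + (t - s) *\<^sub>R b) = (\<lambda>t. a' + (t - s) *\<^sub>R b')"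
      by blast
    then have "(?D ^^ Suc n) (\<lambda>t. a + (t - s) *\<^sub>R b) = (\<lambda>t. b' + (t - s) *\<^sub>R 0)"
      by (simp add: vector_derivative_at[OF has_vector_derivative_affine])
    then show ?case by blast
  qed
  moreover have "(\<lambda>t. a' + (t - s) *\<^sub>R b') differentiable (at t)" for a' b' :: 'a and t
    by (rule differentiableI_vector[OF has_vector_derivative_affine])
  ultimately show ?thesis
    unfolding smooth_curve_on_def by metis
qed

lemma spd_path_near_affine:
  fixes A H :: "real^'m^'m"
  assumes "sym_pos_def A" "transpose H = H"
  shows "spd_path_near \<xi>0 (\<lambda>\<xi>. A + (\<xi> - \<xi>0) *\<^sub>R H)"
proof -
  obtain e where e: "e > 0" "\<And>t. \<bar>t\<bar> < e \<Longrightarrow> sym_pos_def (A + t *\<^sub>R H)"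
    using sym_pos_def_add_small[OF assms] by blast
  then show ?thesis
    unfolding spd_path_near_def
    by (intro exI[of _ "ball \<xi>0 e"])
       (auto simp: smooth_curve_on_affine dist_real_def abs_minus_commute)
qed

lemma visibility_eq_0:
  assumes "((\<lambda>\<xi>. obs_cov S q \<xi> y) has_vector_derivative 0) (at \<xi>0)"
  shows "visibility S q \<xi>0 y = 0"
  by (simp add: visibility_def vector_derivative_at[OF assms] mat_norm_def trace_def)

theorem corollary8p2:
  fixes \<xi>0 q' :: real and q :: "real \<Rightarrow> real"
    and y :: "real^'m" and S0 :: "real^'m^'m"
  assumes "y \<noteq> 0"
    and "sym_pos_def S0"
    and "(q has_real_derivative q') (at \<xi>0)"
  shows "(\<exists>S. spd_path_near \<xi>0 S \<and> S \<xi>0 = S0 \<and>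
            ((\<lambda>\<xi>. obs_cov S q \<xi> y) has_vector_derivative 0) (at \<xi>0)) \<and>
         \<not> (\<exists>c :: real \<Rightarrow> real^'m \<Rightarrow> real.
              (\<forall>p z. z \<noteq> 0 \<longrightarrow> 0 < c p z) \<and>
              (\<forall>S. spd_path_near \<xi>0 S \<and> S \<xi>0 = S0 \<longrightarrow> visibility S q \<xi>0 y \<ge> c q' y))"
proof -
  define H where "H = - q' *\<^sub>R outer y"
  define S where "S = (\<lambda>\<xi>. S0 + (\<xi> - \<xi>0) *\<^sub>R H)"
  have "transpose H = H"
    by (simp add: H_def outer_def transpose_def vec_eq_iff mult.commute)
  then have path: "spd_path_near \<xi>0 S" "S \<xi>0 = S0"
    using assms(2) by (simp_all add: S_def spd_path_near_affine)
  have "((\<lambda>\<xi>. S \<xi> + q \<xi> *\<^sub>R outer y) has_vector_derivative H + q' *\<^sub>R outer y) (at \<xi>0)"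
    unfolding S_def
    using has_vector_derivative_add[OF has_vector_derivative_affine
        has_vector_derivative_scaleR[OF assms(3) has_vector_derivative_const]]
    by simp
  then have stationary: "((\<lambda>\<xi>. obs_cov S q \<xi> y) has_vector_derivative 0) (at \<xi>0)"
    by (simp add: obs_cov_def H_def)
  show ?thesis
  proof (intro conjI notI)
    show "\<exists>S. spd_path_near \<xi>0 S \<and> S \<xi>0 = S0 \<and>
        ((\<lambda>\<xi>. obs_cov S q \<xi> y) has_vector_derivative 0) (at \<xi>0)"
      using path stationary by blast
  next
    assume "\<exists>c :: real \<Rightarrow> real^'m \<Rightarrow> real. (\<forall>p z. z \<noteq> 0 \<longrightarrow> 0 < c p z) \<and>
        (\<forall>S. spd_path_near \<xi>0 S \<and> S \<xi>0 = S0 \<longrightarrow> visibility S q \<xi>0 y \<ge> c q' y)"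
    then obtain c :: "real \<Rightarrow> real^'m \<Rightarrow> real"
      where "0 < c q' y" "c q' y \<le> visibility S q \<xi>0 y"
      using path assms(1) by blast
    then show False
      by (simp add: visibility_eq_0[OF stationary])
  qed
qed

end
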